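(* There is an absolute constant $C>0$ such that for all integers $d\ge2$, $N\ge2$ and $2\le K\le 2^d$, \[ \left|\frac{\#\Omega_K}{\#\mathcal W^K}-\prod_{p\ \text{prime}}\Big(1-\frac1{p^d}\Big)\Big(1-\frac2{p^d}\Big)\cdots\Big(1-\frac{K-1}{p^d}\Big)\right|\le C\left(\frac{dK}{N^{1/2}}+\frac{2^dK^2}{(\log N)^{d-1}}\right). \]
   Context: For integers $d,N\ge1$ let $\mathcal W=[0,N]^d\cap\mathbb Z^d$, so $\#\mathcal W^K=(N+1)^{dK}$. Two points $\mathbf v,\mathbf w\in\mathcal W$ are visible from each other if $\gcd(v_1-w_1,\dots,v_d-w_d)=1$. For $K\ge2$, $\Omega_K$ is the set of $K$-tuples $(\mathbf v_1,\dots,\mathbf v_K)\in\mathcal W^K$ such that $\mathbf v_j$ and $\mathbf v_k$ are visible from each other for all $1\le j\ne k\le K$. *)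

theory Defs
  imports
    "HOL-Analysis.Infinite_Products"
    "HOL-Library.FuncSet"
    "HOL-Computational_Algebra.Primes"
begin

(* Points of Z^d are functions on the index set {..<d}, extended by undefined elsewhere,
   so that the finite sets below have the intended cardinalities. *)
definition lattice_box :: "nat \<Rightarrow> nat \<Rightarrow> (nat \<Rightarrow> int) set" where
  "lattice_box d N = {..<d} \<rightarrow>\<^sub>E {0..int N}"

definition visible :: "nat \<Rightarrow> (nat \<Rightarrow> int) \<Rightarrow> (nat \<Rightarrow> int) \<Rightarrow> bool" where
  "visible d v w \<longleftrightarrow> Gcd ((\<lambda>i. v i - w i) ` {..<d}) = 1"

definition box_tuples :: "nat \<Rightarrow> nat \<Rightarrow> nat \<Rightarrow> (nat \<Rightarrow> nat \<Rightarrow> int) set" where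
  "box_tuples d N K = {..<K} \<rightarrow>\<^sub>E lattice_box d N"

definition visible_tuples :: "nat \<Rightarrow> nat \<Rightarrow> nat \<Rightarrow> (nat \<Rightarrow> nat \<Rightarrow> int) set" where
  "visible_tuples d N K =
     {v \<in> box_tuples d N K. \<forall>j<K. \<forall>k<K. j \<noteq> k \<longrightarrow> visible d (v j) (v k)}"

lemma card_box_tuples: "card (box_tuples d N K) = (N + 1) ^ (d * K)"
  by (simp add: box_tuples_def lattice_box_def card_PiE power_mult nat_add_distrib)

(* The product over all primes, indexed by all naturals with factor 1 at the non-primes. *)
definition visibility_product :: "nat \<Rightarrow> nat \<Rightarrow> real" where
  "visibility_product d K =
     (\<Prod>p. if prime p then (\<Prod>j = 1..K - 1. 1 - real j / real p ^ d) else 1)"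

(* The product converges absolutely, so prodinf takes its actual value and the order of the
   factors does not matter. *)
lemma abs_convergent_visibility_product:
  assumes "d \<ge> 2"
  shows "abs_convergent_prod
           (\<lambda>p::nat. if prime p then (\<Prod>j = 1..K - 1. 1 - real j / real p ^ d) else 1)"
proof -
  define f :: "nat \<Rightarrow> nat \<Rightarrow> real"
    where "f j p = (if prime p then 1 - real j / real p ^ d else 1)" for j p
  have f: "summable (\<lambda>p. \<bar>f j p - 1\<bar>)" for j
  proof (rule summable_comparison_test')
    show "summable (\<lambda>p::nat. real j * inverse (real p ^ d))"
      using assms by (intro summable_mult inverse_power_summable) auto
    show "norm \<bar>f j p - 1\<bar> \<le> real j * inverse (real p ^ d)" if "p \<ge> 0" for p
      by (simp add: f_def field_simps)
  qed
  have f_bound: "\<bar>f j p\<bar> \<le> 1 + real j" for j p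
  proof -
    have "real j / real p ^ d \<le> real j" if "prime p"
    proof -
      have "real p ^ d \<ge> 1"
        using prime_ge_1_nat[OF that] by simp
      then show ?thesis
        by (simp add: divide_le_eq mult_left_le_one_le mult_le_cancel_left1)
    qed
    moreover have "real j / real p ^ d \<ge> 0"
      by simp
    moreover have "\<bar>if prime p then 1 - x else 1\<bar> \<le> 1 + real j"
      if "prime p \<Longrightarrow> x \<le> real j" "x \<ge> 0" for x
      using that by (cases "prime p") auto
    ultimately show ?thesis
      unfolding f_def by blast
  qed
  have "summable (\<lambda>p. \<bar>(\<Prod>j\<in>A. f j p) - 1\<bar>)" if "finite A" for A
    using that
  proof (induction A)
    case empty
    then show ?case by simp
  next
    case (insert a A)
    show ?case
    proof (rule summable_comparison_test')
      show "summable (\<lambda>p. (1 + real a) * \<bar>(\<Prod>j\<in>A. f j p) - 1\<bar> + \<bar>f a p - 1\<bar>)"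
        by (intro summable_add summable_mult insert.IH f)
      fix p :: nat
      have "(\<Prod>j\<in>insert a A. f j p) - 1 = f a p * ((\<Prod>j\<in>A. f j p) - 1) + (f a p - 1)"
        using insert.hyps by (simp add: algebra_simps)
      also have "\<bar>\<dots>\<bar> \<le> \<bar>f a p\<bar> * \<bar>(\<Prod>j\<in>A. f j p) - 1\<bar> + \<bar>f a p - 1\<bar>"
        by (metis abs_mult abs_triangle_ineq)
      also have "\<dots> \<le> (1 + real a) * \<bar>(\<Prod>j\<in>A. f j p) - 1\<bar> + \<bar>f a p - 1\<bar>"
        using f_bound by (intro add_right_mono mult_right_mono) auto
      finally show "norm \<bar>(\<Prod>j\<in>insert a A. f j p) - 1\<bar>
          \<le> (1 + real a) * \<bar>(\<Prod>j\<in>A. f j p) - 1\<bar> + \<bar>f a p - 1\<bar>"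
        by simp
    qed
  qed
  from this[of "{1..K - 1}"] have "abs_convergent_prod (\<lambda>p. \<Prod>j = 1..K - 1. f j p)"
    by (simp add: abs_convergent_prod_conv_summable)
  also have "(\<lambda>p. \<Prod>j = 1..K - 1. f j p) =
      (\<lambda>p. if prime p then (\<Prod>j = 1..K - 1. 1 - real j / real p ^ d) else 1)"
    by (auto simp: f_def fun_eq_iff)
  finally show ?thesis .
qed

end

theory Submission
  imports Defs "HOL-Number_Theory.Cong" "HOL-Real_Asymp.Real_Asymp"
begin

text \<open>
  A tuple is visible iff for every prime \<open>p\<close> its points are distinct modulo \<open>p\<close>. Modulo a
  squarefree \<open>M\<close> the box is equidistributed up to an error \<open>d K M / (N + 1)\<close>, and there the
  Chinese remainder theorem gives the exact density \<open>\<Prod>\<^bsub>p | M\<^esub> \<Prod>\<^bsub>j < K\<^esub> (1 - j / p\<^sup>d)\<close>.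
  Put \<open>m = \<lceil>2 (log N)\<^bsup>1/2\<^esup>\<rceil>\<close>. The primes up to \<open>m\<close> are handled exactly: their product is at
  most \<open>m\<^sup>m\<close>, far below \<open>N\<^bsup>1/2\<^esup>\<close>. The primes in \<open>(m, m\<^sup>2]\<close> are sieved with the first two
  Bonferroni inequalities, both for the box and for the product, so that no modulus exceeds
  \<open>m\<^bsup>m+2\<^esup>\<close>; the second order terms are at most \<open>(K\<^sup>2 / m\<^bsup>d-1\<^esup>)\<^sup>2\<close>, which is admissible
  because \<open>K \<le> 2\<^sup>d\<close> and \<open>m\<^sup>2 \<ge> 4 log N\<close>. Primes beyond \<open>m\<^sup>2 \<ge> log N\<close> are covered by the
  union bound over pairs of points, where each pair contributes at most \<open>(2 / p)\<^sup>d\<close>.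
\<close>

section \<open>Averages over finite sets and over product sets\<close>

text \<open>Expectation under the uniform distribution: densities of tuples become averages of
  \<open>of_bool\<close> indicators. By the convention for division the value is 0 on an empty
  set.\<close>

definition avg :: "'a set \<Rightarrow> ('a \<Rightarrow> real) \<Rightarrow> real" where
  "avg A f = (\<Sum>x\<in>A. f x) / real (card A)"

lemma avg_cong: "(\<And>x. x \<in> A \<Longrightarrow> f x = g x) \<Longrightarrow> avg A f = avg A g"
  by (simp add: avg_def cong: sum.cong)

lemma avg_add: "avg A (\<lambda>x. f x + g x) = avg A f + avg A g"
  by (simp add: avg_def sum.distrib add_divide_distrib)

lemma avg_diff: "avg A (\<lambda>x. f x - g x) = avg A f - avg A g"
  by (simp add: avg_def sum_subtractf diff_divide_distrib)

lemma avg_sum: "avg A (\<lambda>x. \<Sum>i\<in>I. f i x) = (\<Sum>i\<in>I. avg A (f i))"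
  unfolding avg_def by (subst sum.swap) (simp add: sum_divide_distrib)

lemma avg_const: "finite A \<Longrightarrow> A \<noteq> {} \<Longrightarrow> avg A (\<lambda>_. c) = c"
  by (simp add: avg_def)

lemma avg_mono: "(\<And>x. x \<in> A \<Longrightarrow> f x \<le> g x) \<Longrightarrow> avg A f \<le> avg A g"
  by (simp add: avg_def divide_right_mono sum_mono)

lemma avg_nonneg: "(\<And>x. x \<in> A \<Longrightarrow> 0 \<le> f x) \<Longrightarrow> 0 \<le> avg A f"
  by (simp add: avg_def sum_nonneg)

lemma avg_le_1: "(\<And>x. x \<in> A \<Longrightarrow> f x \<le> 1) \<Longrightarrow> avg A f \<le> 1"
proof (cases "card A = 0")
  case False
  assume "\<And>x. x \<in> A \<Longrightarrow> f x \<le> 1"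
  then have "sum f A \<le> real (card A)"
    using sum_bounded_above[of A f 1] by simp
  with False show ?thesis
    by (simp add: avg_def)
qed (simp add: avg_def)

lemma avg_of_bool: "finite A \<Longrightarrow> avg A (\<lambda>x. of_bool (P x)) = real (card {x \<in> A. P x}) / real (card A)"
  by (simp add: avg_def Int_def flip: sum.inter_filter)

lemma avg_swap: "avg A (\<lambda>x. avg B (\<lambda>y. f x y)) = avg B (\<lambda>y. avg A (\<lambda>x. f x y))"
  unfolding avg_def by (subst sum_divide_distrib[symmetric], subst sum.swap)
    (simp add: sum_divide_distrib[symmetric] mult.commute)

text \<open>Fubini for uniform measures: the coordinate \<open>i\<close> is independent of the
  others, and the cardinality of the product set factors accordingly.\<close>

lemma avg_PiE_insert:
  assumes "finite I" "i \<notin> I"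
  shows "avg (PiE (insert i I) (\<lambda>_. A)) g = avg A (\<lambda>x. avg (PiE I (\<lambda>_. A)) (\<lambda>y. g (y(i := x))))"
proof -
  have "(\<Sum>v\<in>PiE (insert i I) (\<lambda>_. A). g v) = (\<Sum>(x, y)\<in>A \<times> PiE I (\<lambda>_. A). g (y(i := x)))"
    using assms unfolding PiE_insert_eq
    by (subst sum.reindex[OF inj_combinator]) (auto simp: case_prod_unfold o_def)
  also have "\<dots> = (\<Sum>x\<in>A. \<Sum>y\<in>PiE I (\<lambda>_. A). g (y(i := x)))"
    by (simp add: sum.cartesian_product)
  finally show ?thesis
    using assms by (simp add: avg_def card_PiE sum_divide_distrib mult.commute)
qed

text \<open>Hybrid argument: the coordinates are switched from \<open>A\<close> to \<open>B\<close> one at a time.\<close>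

lemma avg_PiE_approx:
  fixes R :: "'a \<Rightarrow> 'a \<Rightarrow> bool" and g :: "('i \<Rightarrow> 'a) \<Rightarrow> real"
  assumes "finite I" and refl: "\<And>x. R x x"
    and base: "\<And>h. (\<And>x. 0 \<le> h x \<and> h x \<le> 1) \<Longrightarrow> (\<And>x y. R x y \<Longrightarrow> h x = h y)
          \<Longrightarrow> \<bar>avg A h - avg B h\<bar> \<le> e"
    and fin: "finite A" "A \<noteq> {}"
    and g01: "\<And>v. 0 \<le> g v \<and> g v \<le> 1"
    and gR: "\<And>v w. (\<And>i. i \<in> I \<Longrightarrow> R (v i) (w i)) \<Longrightarrow> g v = g w"
  shows "\<bar>avg (PiE I (\<lambda>_. A)) g - avg (PiE I (\<lambda>_. B)) g\<bar> \<le> real (card I) * e"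
  using assms(1) g01 gR
proof (induction I arbitrary: g rule: finite_induct)
  case empty
  then show ?case by simp
next
  case (insert i I g)
  \<comment> \<open>The coordinates in \<open>I\<close> are averaged out with coordinate
    \<open>i\<close> fixed at \<open>x\<close>. The intermediate hybrid is \<open>avg A gB\<close>:
    the induction hypothesis compares it with \<open>avg A gA\<close>, and \<open>base\<close>
    compares it with \<open>avg B gB\<close>.\<close>
  define gA where "gA x = avg (PiE I (\<lambda>_. A)) (\<lambda>y. g (y(i := x)))" for x
  define gB where "gB x = avg (PiE I (\<lambda>_. B)) (\<lambda>y. g (y(i := x)))" for x
  have eq: "avg (PiE (insert i I) (\<lambda>_. A)) g = avg A gA" "avg (PiE (insert i I) (\<lambda>_. B)) g = avg B gB"
    unfolding gA_def gB_def using insert.hyps by (simp_all add: avg_PiE_insert)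
  have IH: "\<bar>gA x - gB x\<bar> \<le> real (card I) * e" for x
    unfolding gA_def gB_def
  proof (rule insert.IH)
    fix v w assume vw: "\<And>i. i \<in> I \<Longrightarrow> R (v i) (w i)"
    show "g (v(i := x)) = g (w(i := x))"
      by (rule insert.prems(2)) (use vw refl in auto)
  qed (use insert.prems(1) in auto)
  have "\<bar>avg A gA - avg A gB\<bar> \<le> real (card I) * e"
  proof -
    have "avg A (\<lambda>x. gA x - gB x) \<le> avg A (\<lambda>_. real (card I) * e)"
      using IH by (intro avg_mono) (simp add: abs_le_iff)
    moreover have "avg A (\<lambda>x. gB x - gA x) \<le> avg A (\<lambda>_. real (card I) * e)"
      using IH by (intro avg_mono) (simp add: abs_le_iff)
    ultimately show ?thesis
      using fin by (simp add: avg_diff avg_const abs_le_iff)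
  qed
  moreover have "\<bar>avg A gB - avg B gB\<bar> \<le> e"
  proof (rule base)
    show "0 \<le> gB x \<and> gB x \<le> 1" for x
      unfolding gB_def using insert.prems(1) by (auto intro: avg_nonneg avg_le_1)
    show "gB x = gB y" if "R x y" for x y
      unfolding gB_def using that refl by (intro avg_cong insert.prems(2)) auto
  qed
  ultimately have "\<bar>avg A gA - avg B gB\<bar> \<le> real (card I) * e + e"
    by linarith
  then show ?case
    using insert.hyps by (simp add: eq algebra_simps)
qed

section \<open>Equidistribution of the box modulo M\<close>

text \<open>Complete periods inside the interval reproduce the average over one period exactly; only
  the incomplete block at the end, of fewer than \<open>M\<close> points, causes an error.\<close>

lemma avg_periodic_approx:
  fixes h :: "int \<Rightarrow> real" and M N :: nat
  assumes "M > 0" and h01: "\<And>x. 0 \<le> h x \<and> h x \<le> 1"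
    and per: "\<And>x y. [x = y] (mod int M) \<Longrightarrow> h x = h y"
  shows "\<bar>avg {0..int N} h - avg {0..<int M} h\<bar> \<le> real M / real (N + 1)"
proof -
  define H where "H n = (\<Sum>k<n. h (int k))" for n
  have sum_H: "(\<Sum>x\<in>{0..<int n}. h x) = H n" for n
    unfolding H_def using sum.reindex[of int "{..<n}" h]
    by (simp add: image_int_atLeastLessThan lessThan_atLeast0 o_def)
  have "{0..int N} = {0..<int (N + 1)}" by auto
  then have avg_N: "avg {0..int N} h = H (N + 1) / real (N + 1)"
    unfolding avg_def by (simp only: sum_H) simp
  have avg_M: "avg {0..<int M} h = H M / real M"
    unfolding avg_def by (simp only: sum_H) simp
  have shift: "H (q * M + r) = real q * H M + H r" for q r
  proof (induction q)
    case (Suc q)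
    have "H (M + n) = H M + H n" for n
    proof (induction n)
      case (Suc n)
      have "h (int (M + n)) = h (int n)"
        by (rule per) (simp add: Cong.cong_def)
      with Suc show ?case by (simp add: H_def)
    qed (simp add: H_def)
    from this[of "q * M + r"] Suc show ?case
      by (simp add: algebra_simps)
  qed simp
  define q r where "q = (N + 1) div M" and "r = (N + 1) mod M"
  have N: "N + 1 = q * M + r" and r: "r < M"
    using assms(1) by (auto simp: q_def r_def)
  have H_bounds: "0 \<le> H n \<and> H n \<le> real n" for n
    unfolding H_def using h01 sum_bounded_above[of "{..<n}" "\<lambda>k. h (int k)" 1]
    by (auto intro: sum_nonneg)
  \<comment> \<open>The \<open>q\<close> complete periods cancel. What is left compares the partial
    sum \<open>H r\<close> with its expected value; both lie between 0 and \<open>r\<close>.\<close>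
  have "H (N + 1) / real (N + 1) - H M / real M = (H r - real r * (H M / real M)) / real (N + 1)"
  proof -
    have "real (N + 1) = real q * real M + real r" using N by (metis of_nat_add of_nat_mult)
    moreover have "real (N + 1) > 0" by simp
    ultimately show ?thesis
      using assms(1) shift[of q r] unfolding N by (simp add: field_simps)
  qed
  moreover have "\<bar>H r - real r * (H M / real M)\<bar> \<le> real M"
  proof -
    have "0 \<le> H M / real M" "H M / real M \<le> 1"
      using H_bounds[of M] assms(1) by auto
    then have "0 \<le> real r * (H M / real M)" "real r * (H M / real M) \<le> real r"
      by (auto intro!: mult_nonneg_nonneg mult_left_le simp del: times_divide_eq_right)
    with H_bounds[of r] r show ?thesis by linarith
  qed
  ultimately show ?thesis
    unfolding avg_N avg_M by (simp add: divide_right_mono del: of_nat_add of_nat_Suc)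
qed

text \<open>\<open>K\<close>-tuples of points of (Z/MZ)^d, each residue represented in
  \<open>{0..<int M}\<close>. This is the exact model that the box approximates.\<close>

definition torus_tuples :: "nat \<Rightarrow> nat \<Rightarrow> nat \<Rightarrow> (nat \<Rightarrow> nat \<Rightarrow> int) set" where
  "torus_tuples d K M = ({..<K} \<rightarrow>\<^sub>E ({..<d} \<rightarrow>\<^sub>E {0..<int M}))"

lemma finite_box_tuples: "finite (box_tuples d N K)"
  by (simp add: box_tuples_def lattice_box_def finite_PiE)

lemma box_tuples_nonempty: "box_tuples d N K \<noteq> {}"
  by (auto simp: box_tuples_def lattice_box_def PiE_eq_empty_iff)

text \<open>The hybrid argument is applied twice, first to the \<open>d\<close> coordinates of a
  point and then to the \<open>K\<close> points of a tuple, which multiplies the one-dimensional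
  error by \<open>d\<close> and by \<open>K\<close>.\<close>

lemma avg_box_tuples_approx:
  fixes g :: "(nat \<Rightarrow> nat \<Rightarrow> int) \<Rightarrow> real"
  assumes "M > 0" and "\<And>v. 0 \<le> g v \<and> g v \<le> 1"
    and "\<And>v w. (\<And>j i. j < K \<Longrightarrow> i < d \<Longrightarrow> [v j i = w j i] (mod int M)) \<Longrightarrow> g v = g w"
  shows "\<bar>avg (box_tuples d N K) g - avg (torus_tuples d K M) g\<bar>
           \<le> real d * real K * (real M / real (N + 1))"
proof -
  let ?R = "\<lambda>v w. \<forall>i<d. [v i = w i] (mod int M)"
  have "\<bar>avg (lattice_box d N) h - avg ({..<d} \<rightarrow>\<^sub>E {0..<int M}) h\<bar> \<le> real d * (real M / real (N + 1))"
    if "\<And>x. 0 \<le> h x \<and> h x \<le> 1" "\<And>x y. ?R x y \<Longrightarrow> h x = h y" for h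
    unfolding lattice_box_def
    using avg_PiE_approx[of "{..<d}" "\<lambda>x y. [x = y] (mod int M)" "{0..int N}" "{0..<int M}"
        "real M / real (N + 1)" h] avg_periodic_approx[OF assms(1)] that
    by auto
  then have "\<bar>avg (box_tuples d N K) g - avg (torus_tuples d K M) g\<bar>
      \<le> real (card {..<K}) * (real d * (real M / real (N + 1)))"
    unfolding box_tuples_def torus_tuples_def
    by (intro avg_PiE_approx[where R = ?R])
      (use assms in \<open>auto simp: lattice_box_def PiE_eq_empty_iff finite_PiE\<close>)
  then show ?thesis
    by (simp add: mult_ac)
qed

section \<open>Exact densities modulo primes and their products\<close>

lemma prod_of_bool:
  "finite A \<Longrightarrow> (\<Prod>x\<in>A. of_bool (P x)) = (of_bool (\<forall>x\<in>A. P x) :: 'a :: comm_semiring_1)"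
  by (induction A rule: finite_induct) auto

text \<open>Injectivity is the uniqueness of solutions for coprime moduli; surjectivity follows
  because both sides have \<open>a * b\<close> elements.\<close>

lemma bij_betw_chinese_remainder:
  fixes a b :: nat
  assumes "coprime a b" "a > 0" "b > 0"
  shows "bij_betw (\<lambda>x. (x mod int a, x mod int b)) {0..<int (a * b)} ({0..<int a} \<times> {0..<int b})"
proof -
  have inj: "inj_on (\<lambda>x. (x mod int a, x mod int b)) {0..<int (a * b)}"
  proof (rule inj_onI)
    fix x y assume xy: "x \<in> {0..<int (a * b)}" "y \<in> {0..<int (a * b)}"
      and "(x mod int a, x mod int b) = (y mod int a, y mod int b)"
    then have "[x = y] (mod int a)" "[x = y] (mod int b)"
      by (simp_all add: Cong.cong_def)
    with assms(1) have "[x = y] (mod int (a * b))"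
      by (simp add: coprime_cong_mult)
    with xy show "x = y" by (simp add: Cong.cong_def)
  qed
  moreover have "(\<lambda>x. (x mod int a, x mod int b)) ` {0..<int (a * b)} = {0..<int a} \<times> {0..<int b}"
    by (rule card_subset_eq) (use assms inj in \<open>auto simp: card_image card_cartesian_product nat_mult_distrib\<close>)
  ultimately show ?thesis by (simp add: bij_betw_def)
qed

text \<open>Lifts a splitting of values to a splitting of functions. Two applications carry the
  Chinese remainder bijection from integers to points and from points to tuples.\<close>

lemma bij_betw_PiE_prod:
  assumes "bij_betw (\<lambda>x. (\<beta> x, \<gamma> x)) A (B \<times> C)"
  shows "bij_betw (\<lambda>v. (\<lambda>i\<in>I. \<beta> (v i), \<lambda>i\<in>I. \<gamma> (v i))) (PiE I (\<lambda>_. A)) (PiE I (\<lambda>_. B) \<times> PiE I (\<lambda>_. C))"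
proof -
  define \<phi> where "\<phi> = inv_into A (\<lambda>x. (\<beta> x, \<gamma> x))"
  have 1: "\<phi> (\<beta> x, \<gamma> x) = x" "\<beta> x \<in> B" "\<gamma> x \<in> C" if "x \<in> A" for x
    using that assms bij_betw_inv_into_left[OF assms, of x] bij_betw_apply[OF assms, of x]
    by (auto simp: \<phi>_def)
  have 2: "\<phi> (y, z) \<in> A" "\<beta> (\<phi> (y, z)) = y" "\<gamma> (\<phi> (y, z)) = z" if "y \<in> B" "z \<in> C" for y z
    using that bij_betw_inv_into_right[OF assms, of "(y, z)"]
      bij_betw_apply[OF bij_betw_inv_into[OF assms], of "(y, z)"]
    by (auto simp: \<phi>_def)
  show ?thesis
    by (rule bij_betw_byWitness[where f' = "\<lambda>(s, t). \<lambda>i\<in>I. \<phi> (s i, t i)"])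
      (auto simp: 1 2 PiE_iff extensional_def fun_eq_iff split: if_splits)
qed

definition distinct_mod :: "nat \<Rightarrow> nat \<Rightarrow> nat \<Rightarrow> (nat \<Rightarrow> nat \<Rightarrow> int) \<Rightarrow> bool" where
  "distinct_mod d K p v \<longleftrightarrow>
     (\<forall>j<K. \<forall>k<K. j \<noteq> k \<longrightarrow> (\<exists>i<d. \<not> [v j i = v k i] (mod int p)))"

lemma distinct_mod_cong:
  assumes "\<And>j i. j < K \<Longrightarrow> i < d \<Longrightarrow> [v j i = w j i] (mod int p)"
  shows "distinct_mod d K p v \<longleftrightarrow> distinct_mod d K p w"
proof -
  have "[v j i = v k i] (mod int p) \<longleftrightarrow> [w j i = w k i] (mod int p)" if "j < K" "k < K" "i < d" for i j k
    using assms[of j i] assms[of k i] that by (simp add: Cong.cong_def)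
  then show ?thesis
    unfolding distinct_mod_def by blast
qed

text \<open>The Euler factor at \<open>p\<close>. It is also the birthday probability that
  \<open>K\<close> independent uniform points of (Z/pZ)^d are distinct.\<close>

definition local_density :: "nat \<Rightarrow> nat \<Rightarrow> nat \<Rightarrow> real" where
  "local_density d K p = (\<Prod>j = 1..K - 1. 1 - real j / real p ^ d)"

lemma card_torus_tuples: "card (torus_tuples d K M) = M ^ (d * K)"
  by (simp add: torus_tuples_def card_PiE power_mult)

lemma finite_torus_tuples: "finite (torus_tuples d K M)"
  by (simp add: torus_tuples_def finite_PiE)

text \<open>The falling factorial. With subtraction in the reals the formula survives
  \<open>K > card B\<close>: there is no injection then, and the factor with
  \<open>j = card B\<close> vanishes.\<close>

lemma card_inj_PiE:
  assumes "finite B"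
  shows "real (card {f \<in> {..<K} \<rightarrow>\<^sub>E B. inj_on f {..<K}}) = (\<Prod>j<K. real (card B) - real j)"
proof (cases "K \<le> card B")
  case True
  then have "real (card B - j) = real (card B) - real j" if "j < K" for j
    using that by simp
  then show ?thesis
    using assms by (simp add: card_inj_on_subset_funcset lessThan_atLeast0)
next
  case False
  have "\<not> inj_on f {..<K}" if "f \<in> {..<K} \<rightarrow>\<^sub>E B" for f
    using that False card_inj_on_le[of f "{..<K}" B] assms by (auto simp: PiE_def)
  moreover have "(\<Prod>j<K. real (card B) - real j) = 0"
    using False by (intro prod_zero) (auto intro!: bexI[of _ "card B"])
  ultimately show ?thesis by (simp cong: conj_cong)
qed

text \<open>Reduced residues are congruent only when equal, and extensionality turns agreement on
  the \<open>d\<close> coordinates into equality of points.\<close>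

lemma distinct_mod_torus:
  assumes "v \<in> torus_tuples d K p"
  shows "distinct_mod d K p v \<longleftrightarrow> inj_on v {..<K}"
proof -
  have mod: "v j i mod int p = v j i" if "j < K" "i < d" for i j
  proof -
    have "v j i \<in> {0..<int p}" using assms that by (auto simp: torus_tuples_def PiE_iff)
    then show ?thesis by simp
  qed
  have "v j = v k \<longleftrightarrow> (\<forall>i<d. v j i = v k i)" if "j < K" "k < K" for j k
  proof -
    have "v j \<in> extensional {..<d}" "v k \<in> extensional {..<d}"
      using assms that by (auto simp: torus_tuples_def PiE_iff)
    then show ?thesis by (auto intro: extensionalityI)
  qed
  then show ?thesis
    unfolding distinct_mod_def inj_on_def Cong.cong_def by (metis lessThan_iff mod)
qed

lemma avg_torus_prime:
  assumes "p > 0"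
  shows "avg (torus_tuples d K p) (\<lambda>v. of_bool (distinct_mod d K p v)) = local_density d K p"
proof -
  let ?B = "{..<d} \<rightarrow>\<^sub>E {0..<int p}"
  have cardB: "card ?B = p ^ d" "finite ?B"
    by (simp_all add: card_PiE finite_PiE)
  have "{v \<in> torus_tuples d K p. distinct_mod d K p v} = {v \<in> {..<K} \<rightarrow>\<^sub>E ?B. inj_on v {..<K}}"
    using distinct_mod_torus[of _ d K p] by (auto simp: torus_tuples_def)
  then have "avg (torus_tuples d K p) (\<lambda>v. of_bool (distinct_mod d K p v))
      = (\<Prod>j<K. real p ^ d - real j) / (\<Prod>j<K. real p ^ d)"
    using card_inj_PiE[OF cardB(2), of K]
    by (simp add: avg_of_bool finite_torus_tuples card_torus_tuples cardB power_mult)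
  also have "\<dots> = (\<Prod>j<K. 1 - real j / real p ^ d)"
    using assms unfolding prod_dividef[symmetric] by (intro prod.cong) (auto simp: diff_divide_distrib)
  \<comment> \<open>The factor with \<open>j = 0\<close> equals 1 and is dropped.\<close>
  also have "\<dots> = local_density d K p"
    unfolding local_density_def by (rule prod.mono_neutral_right) auto
  finally show ?thesis .
qed

text \<open>By the Chinese remainder theorem, the reductions modulo \<open>a\<close> and modulo
  \<open>b\<close> of a uniform tuple modulo \<open>a * b\<close> are uniform and
  independent.\<close>

lemma avg_torus_mult:
  fixes a b :: nat
  assumes "coprime a b" "a > 0" "b > 0"
    and P: "\<And>v w. (\<And>j i. j < K \<Longrightarrow> i < d \<Longrightarrow> [v j i = w j i] (mod int a)) \<Longrightarrow> P v = P w"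
    and Q: "\<And>v w. (\<And>j i. j < K \<Longrightarrow> i < d \<Longrightarrow> [v j i = w j i] (mod int b)) \<Longrightarrow> Q v = Q w"
  shows "avg (torus_tuples d K (a * b)) (\<lambda>v. P v * Q v) = avg (torus_tuples d K a) P * avg (torus_tuples d K b) Q"
proof -
  define r where "r m v = (\<lambda>j\<in>{..<K}. \<lambda>i\<in>{..<d}. v j i mod int m)" for m v
  have "bij_betw (\<lambda>v. (r a v, r b v)) (torus_tuples d K (a * b)) (torus_tuples d K a \<times> torus_tuples d K b)"
    unfolding torus_tuples_def r_def
    by (intro bij_betw_PiE_prod bij_betw_chinese_remainder assms)
  then have "(\<Sum>v\<in>torus_tuples d K (a * b). (\<lambda>(x, y). P x * Q y) (r a v, r b v))
      = (\<Sum>(x, y)\<in>torus_tuples d K a \<times> torus_tuples d K b. P x * Q y)"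
    by (rule sum.reindex_bij_betw)
  moreover have "P (r a v) = P v" "Q (r b v) = Q v" for v
    by (rule P Q; simp add: r_def Cong.cong_def)+
  ultimately show ?thesis
    by (simp add: avg_def card_torus_tuples power_mult_distrib sum_product sum.cartesian_product)
qed

lemma avg_torus_primes:
  assumes "finite Q" "\<And>p. p \<in> Q \<Longrightarrow> prime p"
  shows "avg (torus_tuples d K (\<Prod>Q)) (\<lambda>v. \<Prod>p\<in>Q. of_bool (distinct_mod d K p v))
          = (\<Prod>p\<in>Q. local_density d K p)"
  using assms
proof (induction Q)
  case empty
  then show ?case
    by (simp add: avg_const finite_torus_tuples) (simp add: avg_def card_torus_tuples)
next
  case (insert p Q)
  have cop: "coprime p (\<Prod>Q)"
    using insert by (intro prod_coprime_right primes_coprime) auto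
  have "avg (torus_tuples d K (p * \<Prod>Q))
      (\<lambda>v. of_bool (distinct_mod d K p v) * (\<Prod>q\<in>Q. of_bool (distinct_mod d K q v)))
    = avg (torus_tuples d K p) (\<lambda>v. of_bool (distinct_mod d K p v))
      * avg (torus_tuples d K (\<Prod>Q)) (\<lambda>v. \<Prod>q\<in>Q. of_bool (distinct_mod d K q v))"
  proof (rule avg_torus_mult[OF cop])
    show "p > 0" "\<Prod>Q > 0"
      using insert.prems by (auto intro!: prod_pos simp: prime_gt_0_nat)
    fix v w :: "nat \<Rightarrow> nat \<Rightarrow> int"
    {
      assume "\<And>j i. j < K \<Longrightarrow> i < d \<Longrightarrow> [v j i = w j i] (mod int p)"
      then show "of_bool (distinct_mod d K p v) = (of_bool (distinct_mod d K p w) :: real)"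
        using distinct_mod_cong by presburger
    next
      assume *: "\<And>j i. j < K \<Longrightarrow> i < d \<Longrightarrow> [v j i = w j i] (mod int (\<Prod>Q))"
      have "distinct_mod d K q v = distinct_mod d K q w" if "q \<in> Q" for q
      proof (rule distinct_mod_cong)
        fix j i assume "j < K" "i < d"
        moreover have "int q dvd int (\<Prod>Q)"
          using that insert.hyps(1) by (simp only: of_nat_dvd_iff) (rule dvd_prodI[of Q q "\<lambda>x. x"])
        ultimately show "[v j i = w j i] (mod int q)"
          using * cong_dvd_modulus by blast
      qed
      then show "(\<Prod>q\<in>Q. of_bool (distinct_mod d K q v)) = (\<Prod>q\<in>Q. of_bool (distinct_mod d K q w) :: real)"
        by simp
    }
  qed
  with insert show ?case
    by (simp add: avg_torus_prime prime_gt_0_nat)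
qed

text \<open>Equidistribution combined with the exact density on the torus. The error grows with the
  product of the primes in \<open>Q\<close>, so it is useful only while that product stays well
  below \<open>N\<close>.\<close>

lemma avg_box_primes_approx:
  assumes "finite Q" "\<And>p. p \<in> Q \<Longrightarrow> prime p"
  shows "\<bar>avg (box_tuples d N K) (\<lambda>v. \<Prod>p\<in>Q. of_bool (distinct_mod d K p v))
          - (\<Prod>p\<in>Q. local_density d K p)\<bar> \<le> real d * real K * (real (\<Prod>Q) / real (N + 1))"
proof -
  let ?g = "\<lambda>v. \<Prod>p\<in>Q. of_bool (distinct_mod d K p v) :: real"
  have "\<bar>avg (box_tuples d N K) ?g - avg (torus_tuples d K (\<Prod>Q)) ?g\<bar> \<le> real d * real K * (real (\<Prod>Q) / real (N + 1))"
  proof (rule avg_box_tuples_approx)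
    show "\<Prod>Q > 0"
      using assms by (auto intro!: prod_pos simp: prime_gt_0_nat)
    show "0 \<le> (\<Prod>p\<in>Q. of_bool (distinct_mod d K p v) :: real)
        \<and> (\<Prod>p\<in>Q. of_bool (distinct_mod d K p v)) \<le> (1 :: real)" for v
      by (auto intro!: prod_nonneg prod_le_1)
    fix v w :: "nat \<Rightarrow> nat \<Rightarrow> int"
    assume *: "\<And>j i. j < K \<Longrightarrow> i < d \<Longrightarrow> [v j i = w j i] (mod int (\<Prod>Q))"
    have "distinct_mod d K q v = distinct_mod d K q w" if "q \<in> Q" for q
    proof (rule distinct_mod_cong)
      fix j i assume "j < K" "i < d"
      moreover have "int q dvd int (\<Prod>Q)"
        using that assms(1) by (simp only: of_nat_dvd_iff) (rule dvd_prodI[of Q q "\<lambda>x. x"])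
      ultimately show "[v j i = w j i] (mod int q)"
        using * cong_dvd_modulus by blast
    qed
    then show "(\<Prod>q\<in>Q. of_bool (distinct_mod d K q v)) = (\<Prod>q\<in>Q. of_bool (distinct_mod d K q w) :: real)"
      by simp
  qed
  then show ?thesis
    by (simp add: avg_torus_primes assms)
qed

section \<open>Product inequalities and bounds for the Euler factors\<close>

text \<open>The second Bonferroni inequality, with ordered pairs and hence twice the sharp second
  order term. In the induction the new factor multiplies the old product by \<open>- x a\<close>, so
  a lower bound for that product is needed there: the Weierstrass inequality.\<close>

lemma prod_one_minus_le:
  fixes x :: "'a \<Rightarrow> real"
  assumes "finite R" "\<And>p. p \<in> R \<Longrightarrow> x p \<in> {0..1}"
  shows "(\<Prod>p\<in>R. 1 - x p) \<le> 1 - (\<Sum>p\<in>R. x p) + (\<Sum>p\<in>R. \<Sum>q\<in>R - {p}. x p * x q)"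
  using assms
proof (induction R)
  case (insert a R)
  have "(\<Prod>p\<in>insert a R. 1 - x p) = (\<Prod>p\<in>R. 1 - x p) - x a * (\<Prod>p\<in>R. 1 - x p)"
    using insert.hyps by (simp add: algebra_simps)
  also have "\<dots> \<le> (1 - (\<Sum>p\<in>R. x p) + (\<Sum>p\<in>R. \<Sum>q\<in>R - {p}. x p * x q)) - x a * (1 - (\<Sum>p\<in>R. x p))"
    using insert Weierstrass_prod_ineq[of R x] by (intro diff_mono mult_left_mono) auto
  also have "\<dots> = 1 - (\<Sum>p\<in>insert a R. x p) + ((\<Sum>p\<in>R. \<Sum>q\<in>R - {p}. x p * x q) + x a * (\<Sum>p\<in>R. x p))"
    using insert.hyps by (simp add: algebra_simps)
  \<comment> \<open>The new pairs with \<open>a\<close> in first place give \<open>x a\<close> times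
    the sum; those with \<open>a\<close> in second place are nonnegative surplus.\<close>
  also have "\<dots> \<le> 1 - (\<Sum>p\<in>insert a R. x p) + (\<Sum>p\<in>insert a R. \<Sum>q\<in>insert a R - {p}. x p * x q)"
  proof -
    have "(\<Sum>q\<in>insert a R - {p}. x p * x q) \<ge> (\<Sum>q\<in>R - {p}. x p * x q)" if "p \<in> R" for p
      using insert.hyps insert.prems that by (intro sum_mono2) auto
    then have "(\<Sum>p\<in>R. \<Sum>q\<in>insert a R - {p}. x p * x q) \<ge> (\<Sum>p\<in>R. \<Sum>q\<in>R - {p}. x p * x q)"
      by (rule sum_mono)
    then show ?thesis
      using insert.hyps by (simp add: sum_distrib_left)
  qed
  finally show ?case .
qed simp

text \<open>The extra factors multiply to at most 1 and, by the Weierstrass inequality, to at least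
  1 minus the sum of their defects; the remaining product is at most 1.\<close>

lemma prod_diff_subset_bounds:
  fixes f :: "'a \<Rightarrow> real"
  assumes "finite B" "A \<subseteq> B" "\<And>x. x \<in> B \<Longrightarrow> f x \<in> {0..1}"
  shows "prod f B \<le> prod f A" "prod f A - prod f B \<le> (\<Sum>x\<in>B - A. 1 - f x)"
proof -
  have eq: "prod f B = prod f A * prod f (B - A)"
    using prod.subset_diff[OF assms(2,1)] by (simp add: mult.commute)
  have A: "0 \<le> prod f A" "prod f A \<le> 1"
    using assms by (auto intro!: prod_nonneg prod_le_1)
  have BA: "prod f (B - A) \<le> 1"
    using assms by (auto intro!: prod_le_1)
  show "prod f B \<le> prod f A"
    unfolding eq using A BA by (simp add: mult_left_le)
  have "1 - (\<Sum>x\<in>B - A. 1 - f x) \<le> prod f (B - A)"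
    using Weierstrass_prod_ineq[of "B - A" "\<lambda>x. 1 - f x"] assms by auto
  then have "1 - prod f (B - A) \<le> (\<Sum>x\<in>B - A. 1 - f x)"
    by simp
  moreover have "prod f A * (1 - prod f (B - A)) \<le> 1 * (1 - prod f (B - A))"
    using A BA by (intro mult_right_mono) auto
  ultimately show "prod f A - prod f B \<le> (\<Sum>x\<in>B - A. 1 - f x)"
    unfolding eq by (simp add: algebra_simps)
qed

text \<open>Since \<open>K \<le> 2 ^ d \<le> p ^ d\<close>, every factor lies in the unit interval.
  The Weierstrass inequality then sums fewer than \<open>K\<close> defects (none if
  \<open>K = 0\<close>), each at most \<open>K / p ^ d\<close>.\<close>

lemma local_density_bounds:
  assumes "K \<le> 2 ^ d" "p \<ge> 2"
  shows "local_density d K p \<in> {0..1}" "1 - local_density d K p \<le> (real K)\<^sup>2 / real p ^ d"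
proof -
  have *: "real j / real p ^ d \<in> {0..1}" if "j \<in> {1..K - 1}" for j
  proof -
    have "real j \<le> real (2 ^ d)"
      using that assms(1) by (intro of_nat_mono) auto
    also have "\<dots> \<le> real p ^ d"
      using assms(2) by (simp add: power_mono)
    finally show ?thesis
      using assms(2) by simp
  qed
  then show "local_density d K p \<in> {0..1}"
    unfolding local_density_def by (auto intro!: prod_nonneg prod_le_1)
  have "1 - local_density d K p \<le> (\<Sum>j = 1..K - 1. real j / real p ^ d)"
    using Weierstrass_prod_ineq[of "{1..K - 1}" "\<lambda>j. real j / real p ^ d", OF *]
    unfolding local_density_def by linarith
  also have "\<dots> \<le> (\<Sum>j = 1..K - 1. real K / real p ^ d)"
    by (intro sum_mono divide_right_mono) auto
  also have "\<dots> \<le> (real K)\<^sup>2 / real p ^ d"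
    by (simp add: power2_eq_square divide_right_mono mult_right_mono)
  finally show "1 - local_density d K p \<le> (real K)\<^sup>2 / real p ^ d" .
qed

text \<open>Two of the \<open>d\<close> powers of \<open>n\<close> give a telescoping sum bounded by
  \<open>1 / a\<close>; each of the other \<open>d - 2\<close> is bounded using
  \<open>n > a\<close>.\<close>

lemma sum_inverse_power_tail:
  assumes "d \<ge> 2" "a > 0"
  shows "(\<Sum>n\<in>{a<..b}. 1 / real n ^ d) \<le> 1 / real a ^ (d - 1)"
proof (cases "a \<le> b")
  case True
  have sq: "(\<Sum>n\<in>{a<..b}. 1 / real n ^ 2) \<le> 1 / real a - 1 / real b"
    using True
  proof (induction b rule: dec_induct)
    case (step b)
    have "{a<..Suc b} = insert (Suc b) {a<..b}"
      using step.hyps by auto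
    then have "(\<Sum>n\<in>{a<..Suc b}. 1 / real n ^ 2) \<le> 1 / real (Suc b) ^ 2 + (1 / real a - 1 / real b)"
      using step.IH by simp
    also have "1 / real (Suc b) ^ 2 \<le> 1 / real b - 1 / real (Suc b)"
      using step.hyps assms(2) by (simp add: divide_simps power2_eq_square)
    finally show ?case by simp
  qed simp
  obtain e where e: "d = e + 2"
    using assms(1) le_Suc_ex by (metis add.commute)
  have pow: "x ^ d = x ^ (d - 2) * x ^ 2" "x ^ (d - 1) = x ^ (d - 2) * x" for x :: real
    unfolding e by (simp_all add: power_add power2_eq_square)
  have "(\<Sum>n\<in>{a<..b}. 1 / real n ^ d) \<le> (\<Sum>n\<in>{a<..b}. 1 / real a ^ (d - 2) * (1 / real n ^ 2))"
    unfolding pow(1) using assms(2)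
    by (intro sum_mono) (auto simp: divide_simps intro!: mult_right_mono power_mono)
  also have "\<dots> = 1 / real a ^ (d - 2) * (\<Sum>n\<in>{a<..b}. 1 / real n ^ 2)"
    by (simp add: sum_distrib_left)
  also have "\<dots> \<le> 1 / real a ^ (d - 2) * (1 / real a)"
    using sq by (intro mult_left_mono) (auto intro: order_trans)
  also have "\<dots> = 1 / real a ^ (d - 1)"
    unfolding pow(2) by simp
  finally show ?thesis .
qed simp

text \<open>Every partial product beyond \<open>n\<close> differs from the one up to
  \<open>n\<close> by at most the tail of \<open>K^2 / p ^ d\<close>; the bound is uniform and
  passes to the limit.\<close>

lemma visibility_product_approx:
  assumes "d \<ge> 2" "K \<le> 2 ^ d" "n > 0"
  shows "\<bar>visibility_product d K - (\<Prod>p | prime p \<and> p \<le> n. local_density d K p)\<bar>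
           \<le> (real K)\<^sup>2 / real n ^ (d - 1)"
proof -
  let ?f = "\<lambda>p. if prime p then local_density d K p else 1"
  have "convergent_prod ?f"
    using abs_convergent_visibility_product[OF assms(1)] abs_convergent_prod_imp_convergent_prod
    unfolding local_density_def by blast
  then have "(\<lambda>m. \<Prod>p\<le>m. ?f p) \<longlonglongrightarrow> prodinf ?f"
    by (rule convergent_prod_LIMSEQ)
  also have "prodinf ?f = visibility_product d K"
    unfolding visibility_product_def local_density_def ..
  also have "(\<lambda>m. \<Prod>p\<le>m. ?f p) = (\<lambda>m. \<Prod>p | prime p \<and> p \<le> m. local_density d K p)"
    by (rule ext, subst prod.inter_filter[symmetric]) (auto intro!: prod.cong)
  finally have lim: "(\<lambda>m. \<Prod>p | prime p \<and> p \<le> m. local_density d K p) \<longlonglongrightarrow> visibility_product d K" .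
  have "\<bar>(\<Prod>p | prime p \<and> p \<le> m. local_density d K p) - (\<Prod>p | prime p \<and> p \<le> n. local_density d K p)\<bar>
      \<le> (real K)\<^sup>2 / real n ^ (d - 1)" if "m \<ge> n" for m
  proof -
    let ?A = "{p. prime p \<and> p \<le> n}" and ?B = "{p. prime p \<and> p \<le> m}"
    have AB: "finite ?B" "?A \<subseteq> ?B" "\<And>p. p \<in> ?B \<Longrightarrow> local_density d K p \<in> {0..1}"
      using that local_density_bounds(1)[OF assms(2)] prime_ge_2_nat by auto
    have "(\<Sum>p\<in>?B - ?A. 1 - local_density d K p) \<le> (\<Sum>p\<in>?B - ?A. (real K)\<^sup>2 / real p ^ d)"
      by (intro sum_mono local_density_bounds assms) (auto intro: prime_ge_2_nat)
    also have "\<dots> \<le> (\<Sum>p\<in>{n<..m}. (real K)\<^sup>2 / real p ^ d)"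
      by (intro sum_mono2) auto
    also have "\<dots> = (real K)\<^sup>2 * (\<Sum>p\<in>{n<..m}. 1 / real p ^ d)"
      by (simp add: sum_distrib_left)
    also have "\<dots> \<le> (real K)\<^sup>2 * (1 / real n ^ (d - 1))"
      by (intro mult_left_mono sum_inverse_power_tail assms) auto
    finally show ?thesis
      using prod_diff_subset_bounds[of ?B ?A "local_density d K", OF AB(1,2)] AB(3) by simp
  qed
  then have ev: "eventually (\<lambda>m. \<bar>(\<Prod>p | prime p \<and> p \<le> m. local_density d K p)
      - (\<Prod>p | prime p \<and> p \<le> n. local_density d K p)\<bar> \<le> (real K)\<^sup>2 / real n ^ (d - 1)) sequentially"
    by (rule eventually_sequentiallyI)
  show ?thesis
    by (rule tendsto_upperbound[OF tendsto_rabs[OF tendsto_diff[OF lim tendsto_const]] ev]) simp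
qed

section \<open>Visibility through primes, and the large primes\<close>

lemma visible_iff:
  "visible d v w \<longleftrightarrow> (\<forall>p. prime p \<longrightarrow> (\<exists>i<d. \<not> [v i = w i] (mod int p)))"
proof -
  let ?g = "Gcd ((\<lambda>i. v i - w i) ` {..<d})"
  have dvd_iff: "x dvd ?g \<longleftrightarrow> (\<forall>i<d. [v i = w i] (mod x))" for x
    by (auto simp: cong_iff_dvd_diff dvd_Gcd_iff)
  show ?thesis
  proof
    assume "visible d v w"
    then have "\<not> int p dvd ?g" if "prime p" for p
      using that by (auto simp: visible_def)
    then show "\<forall>p. prime p \<longrightarrow> (\<exists>i<d. \<not> [v i = w i] (mod int p))"
      by (simp add: dvd_iff)
  next
    assume *: "\<forall>p. prime p \<longrightarrow> (\<exists>i<d. \<not> [v i = w i] (mod int p))"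
    have "?g = 1"
    proof (rule ccontr)
      assume "?g \<noteq> 1"
      \<comment> \<open>The gcd may be 0, namely when the points coincide;
        \<open>prime_factor_nat\<close> covers this case too, as every prime divides 0.\<close>
      then have "nat ?g \<noteq> 1"
        using Gcd_int_greater_eq_0[of "(\<lambda>i. v i - w i) ` {..<d}"] by linarith
      then obtain p where "prime p" "p dvd nat ?g"
        using prime_factor_nat by blast
      then have "int p dvd ?g"
        using Gcd_int_greater_eq_0[of "(\<lambda>i. v i - w i) ` {..<d}"] by (simp add: int_dvd_int_iff[symmetric])
      with * \<open>prime p\<close> show False
        unfolding dvd_iff by blast
    qed
    then show "visible d v w"
      by (simp add: visible_def)
  qed
qed

lemma visible_tuples_eq:
  "visible_tuples d N K = {v \<in> box_tuples d N K. \<forall>p. prime p \<longrightarrow> distinct_mod d K p v}"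
  unfolding visible_tuples_def visible_iff distinct_mod_def by blast

text \<open>Division by \<open>p\<close> is injective on a residue class, so the class has at most
  \<open>N div p + 1\<close> members; \<open>p \<le> N\<close> lets the summand 1 be absorbed, which
  doubles the constant.\<close>

lemma card_residue_class_le:
  fixes p N :: nat
  assumes "0 < p" "p \<le> N"
  shows "real (card {x \<in> {0..int N}. [a = x] (mod int p)}) \<le> 2 / real p * real (N + 1)"
proof -
  let ?X = "{x \<in> {0..int N}. [a = x] (mod int p)}"
  have "inj_on (\<lambda>x. x div int p) ?X"
    by (rule inj_onI) (metis (no_types, lifting) Cong.cong_def mem_Collect_eq div_mult_mod_eq)
  moreover have "(\<lambda>x. x div int p) ` ?X \<subseteq> {0..int (N div p)}"
    using assms(1) by (auto simp: zdiv_int pos_imp_zdiv_nonneg_iff intro!: zdiv_mono1)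
  ultimately have "card ?X \<le> card {0..int (N div p)}"
    by (intro card_inj_on_le) auto
  then have "real (card ?X) \<le> real (N div p) + 1"
    by simp
  also have "\<dots> \<le> real N / real p + 1"
    using of_nat_div_le_of_nat[of N p] by simp
  also have "\<dots> \<le> real N / real p + real N / real p"
  proof -
    have "1 \<le> real N / real p"
      using assms by simp
    then show ?thesis by linarith
  qed
  also have "\<dots> \<le> 2 / real p * real (N + 1)"
    using divide_right_mono[of "2 * real N" "2 * real (N + 1)" "real p"] by simp
  finally show ?thesis .
qed

text \<open>With all points except \<open>v k\<close> fixed, each of the \<open>d\<close>
  coordinates of \<open>v k\<close> has to hit a prescribed residue class, independently and with
  probability at most \<open>2 / p\<close>.\<close>

lemma avg_box_pair_cong_le:
  assumes "0 < p" "p \<le> N" "j < K" "k < K" "j \<noteq> k"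
  shows "avg (box_tuples d N K) (\<lambda>v. of_bool (\<forall>i<d. [v j i = v k i] (mod int p))) \<le> (2 / real p) ^ d"
proof -
  let ?I = "{..<K} - {k}" and ?W = "lattice_box d N"
  have ins: "{..<K} = insert k ?I"
    using assms by auto
  have fin: "finite ?W" "?W \<noteq> {}"
    by (auto simp: lattice_box_def finite_PiE PiE_eq_empty_iff)
  have *: "avg ?W (\<lambda>x. of_bool (\<forall>i<d. [a i = x i] (mod int p))) \<le> (2 / real p) ^ d" for a
  proof -
    have "{x \<in> ?W. \<forall>i<d. [a i = x i] (mod int p)}
        = PiE {..<d} (\<lambda>i. {x \<in> {0..int N}. [a i = x] (mod int p)})"
    proof (rule set_eqI)
      show "x \<in> {x \<in> ?W. \<forall>i<d. [a i = x i] (mod int p)}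
          \<longleftrightarrow> x \<in> PiE {..<d} (\<lambda>i. {x \<in> {0..int N}. [a i = x] (mod int p)})" for x
        unfolding lattice_box_def PiE_iff mem_Collect_eq lessThan_iff by blast
    qed
    then have "real (card {x \<in> ?W. \<forall>i<d. [a i = x i] (mod int p)})
        = (\<Prod>i<d. real (card {x \<in> {0..int N}. [a i = x] (mod int p)}))"
      by (simp add: card_PiE)
    also have "\<dots> \<le> (\<Prod>i<d. 2 / real p * real (N + 1))"
      using card_residue_class_le[OF assms(1,2)] by (intro prod_mono) auto
    also have "\<dots> = (2 / real p) ^ d * real (N + 1) ^ d"
      by (simp only: prod_constant card_lessThan power_mult_distrib)
    finally show ?thesis
      using fin by (simp add: avg_of_bool lattice_box_def card_PiE divide_le_eq add.commute)
  qed
  have "avg (box_tuples d N K) (\<lambda>v. of_bool (\<forall>i<d. [v j i = v k i] (mod int p)))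
      = avg ?W (\<lambda>x. avg (PiE ?I (\<lambda>_. ?W)) (\<lambda>y. of_bool (\<forall>i<d. [y j i = x i] (mod int p))))"
    unfolding box_tuples_def by (subst ins, subst avg_PiE_insert) (use assms in auto)
  also have "\<dots> = avg (PiE ?I (\<lambda>_. ?W)) (\<lambda>y. avg ?W (\<lambda>x. of_bool (\<forall>i<d. [y j i = x i] (mod int p))))"
    by (rule avg_swap)
  also have "\<dots> \<le> avg (PiE ?I (\<lambda>_. ?W)) (\<lambda>_. (2 / real p) ^ d)"
    by (intro avg_mono *)
  also have "\<dots> = (2 / real p) ^ d"
    using fin by (intro avg_const) (auto simp: finite_PiE PiE_eq_empty_iff)
  finally show ?thesis .
qed

text \<open>Union bound over pairs and moduli. A tuple that passes the conditions up to
  \<open>n\<close> but is not visible has a pair congruent modulo some prime in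
  \<open>{n<..N}\<close>; the sum runs over all integers there.\<close>

lemma visible_tuples_avg_bounds:
  assumes "d \<ge> 2" "n \<ge> 2"
  defines "Q \<equiv> {p. prime p \<and> p \<le> n}"
  shows "\<bar>real (card (visible_tuples d N K)) / real (card (box_tuples d N K))
      - avg (box_tuples d N K) (\<lambda>v. \<Prod>p\<in>Q. of_bool (distinct_mod d K p v))\<bar>
    \<le> 2 ^ d * (real K)\<^sup>2 / real n ^ (d - 1)"
proof -
  let ?W = "box_tuples d N K"
  let ?vis = "\<lambda>v. of_bool (\<forall>p. prime p \<longrightarrow> distinct_mod d K p v) :: real"
  let ?g = "\<lambda>v. (\<Prod>p\<in>Q. of_bool (distinct_mod d K p v)) :: real"
  let ?b = "\<lambda>j k p v. of_bool (\<forall>i<d. [v j i = v k i] (mod int p)) :: real"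
  have finQ: "finite Q" by (simp add: Q_def)
  have g_eq: "?g v = of_bool (\<forall>p\<in>Q. distinct_mod d K p v)" for v
    by (rule prod_of_bool[OF finQ])
  have vis: "real (card (visible_tuples d N K)) / real (card ?W) = avg ?W ?vis"
    by (simp add: avg_of_bool finite_box_tuples visible_tuples_eq)
  have lower: "avg ?W ?vis \<le> avg ?W ?g"
    unfolding g_eq by (intro avg_mono) (auto simp: Q_def)
  have "?g v \<le> ?vis v + (\<Sum>j<K. \<Sum>k\<in>{..<K} - {j}. \<Sum>p\<in>{n<..N}. ?b j k p v)" if v: "v \<in> ?W" for v
  proof (cases "(\<forall>p\<in>Q. distinct_mod d K p v) \<and> \<not> (\<forall>p. prime p \<longrightarrow> distinct_mod d K p v)")
    case True
    then obtain p where p: "prime p" "\<not> distinct_mod d K p v" by blast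
    then obtain j k where jk: "j < K" "k < K" "j \<noteq> k" and cong: "\<forall>i<d. [v j i = v k i] (mod int p)"
      by (auto simp: distinct_mod_def)
    \<comment> \<open>The condition at 2, available because \<open>n \<ge> 2\<close>, shows that the
      two points differ in some coordinate. A nonzero difference in the box is at most
      \<open>N\<close> in absolute value, which forces \<open>p \<le> N\<close>.\<close>
    have "distinct_mod d K 2 v"
      using True assms(2) by (simp add: Q_def)
    then obtain i where i: "i < d" "\<not> [v j i = v k i] (mod int 2)"
      using jk unfolding distinct_mod_def by blast
    then have "v j i - v k i \<noteq> 0"
      by auto
    moreover have "int p dvd v j i - v k i"
      using cong i(1) by (simp add: cong_iff_dvd_diff)
    moreover have "v j i \<in> {0..int N}" "v k i \<in> {0..int N}"
      using v jk i(1) by (auto simp: box_tuples_def lattice_box_def PiE_iff)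
    then have "\<bar>v j i - v k i\<bar> \<le> int N" by auto
    ultimately have "int p \<le> int N"
      using dvd_imp_le_int[of "v j i - v k i" "int p"] by simp
    moreover have "n < p"
      using True p by (force simp: Q_def)
    ultimately have pN: "p \<in> {n<..N}" by simp
    have "1 = ?b j k p v"
      using cong by simp
    also have "\<dots> \<le> (\<Sum>p\<in>{n<..N}. ?b j k p v)"
      using pN by (intro member_le_sum) auto
    also have "\<dots> \<le> (\<Sum>k\<in>{..<K} - {j}. \<Sum>p\<in>{n<..N}. ?b j k p v)"
      using jk by (intro member_le_sum[of k _ "\<lambda>k. \<Sum>p\<in>{n<..N}. ?b j k p v"]) (auto intro!: sum_nonneg)
    also have "\<dots> \<le> (\<Sum>j<K. \<Sum>k\<in>{..<K} - {j}. \<Sum>p\<in>{n<..N}. ?b j k p v)"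
      using jk by (intro member_le_sum[of j _ "\<lambda>j. \<Sum>k\<in>{..<K} - {j}. \<Sum>p\<in>{n<..N}. ?b j k p v"])
        (auto intro!: sum_nonneg)
    finally show ?thesis
      using True unfolding g_eq by simp
  next
    case False
    have "(\<Sum>j<K. \<Sum>k\<in>{..<K} - {j}. \<Sum>p\<in>{n<..N}. ?b j k p v) \<ge> 0"
      by (intro sum_nonneg) auto
    with False show ?thesis
      unfolding g_eq by auto
  qed
  then have "avg ?W ?g \<le> avg ?W (\<lambda>v. ?vis v + (\<Sum>j<K. \<Sum>k\<in>{..<K} - {j}. \<Sum>p\<in>{n<..N}. ?b j k p v))"
    by (rule avg_mono)
  also have "\<dots> = avg ?W ?vis + (\<Sum>j<K. \<Sum>k\<in>{..<K} - {j}. \<Sum>p\<in>{n<..N}. avg ?W (?b j k p))"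
    by (simp only: avg_add avg_sum)
  also have "(\<Sum>j<K. \<Sum>k\<in>{..<K} - {j}. \<Sum>p\<in>{n<..N}. avg ?W (?b j k p))
      \<le> (\<Sum>j<K. \<Sum>k\<in>{..<K} - {j}. \<Sum>p\<in>{n<..N}. (2 / real p) ^ d)"
  proof -
    have "avg ?W (?b j k p) \<le> (2 / real p) ^ d" if "j < K" "k \<in> {..<K} - {j}" "p \<in> {n<..N}" for j k p
      using that by (intro avg_box_pair_cong_le) auto
    then show ?thesis
      by (intro sum_mono) auto
  qed
  also have "\<dots> \<le> (\<Sum>j<K. \<Sum>k<K. \<Sum>p\<in>{n<..N}. (2 / real p) ^ d)"
    by (rule sum_mono) (intro sum_mono2; auto intro!: sum_nonneg)
  also have "\<dots> = 2 ^ d * (real K)\<^sup>2 * (\<Sum>p\<in>{n<..N}. 1 / real p ^ d)"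
    by (simp add: power_divide power2_eq_square sum_distrib_left mult_ac)
  also have "\<dots> \<le> 2 ^ d * (real K)\<^sup>2 * (1 / real n ^ (d - 1))"
    using assms by (intro mult_left_mono sum_inverse_power_tail) auto
  finally show ?thesis
    unfolding vis using lower by (simp add: abs_le_iff)
qed

section \<open>Bonferroni sieve for the primes of middle size\<close>

text \<open>Box average and Euler product are enclosed by the same truncated expansions over
  \<open>R\<close>, whose terms are compared one by one. Orders 0 and 1 keep all primes up to
  \<open>m\<close>; order 2 drops them, so its moduli are at most \<open>n^2\<close>.\<close>

lemma avg_box_sieve:
  assumes K: "K \<le> 2 ^ d" and m: "0 < m" "m \<le> n"
  defines "R \<equiv> {p. prime p \<and> m < p \<and> p \<le> n}"
  shows "\<bar>avg (box_tuples d N K) (\<lambda>v. \<Prod>p | prime p \<and> p \<le> n. of_bool (distinct_mod d K p v))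
          - (\<Prod>p | prime p \<and> p \<le> n. local_density d K p)\<bar>
         \<le> real d * real K / real (N + 1) * (real n * real m ^ m * (1 + 2 * real n) + 3 * real n ^ 4)
           + (\<Sum>p\<in>R. 1 - local_density d K p)\<^sup>2"
proof -
  let ?W = "box_tuples d N K"
  define S where "S = {p. prime p \<and> p \<le> m}"
  define g where "g Q v = (\<Prod>p\<in>Q. of_bool (distinct_mod d K p v) :: real)" for Q v
  define F where "F Q = (\<Prod>p\<in>Q. local_density d K p)" for Q
  define x where "x p v = (1 - of_bool (distinct_mod d K p v) :: real)" for p v
  define y where "y p = 1 - local_density d K p" for p
  \<comment> \<open>An average with modulus at most \<open>b\<close> has error at most
    \<open>e * b\<close>. \<open>B\<close> bounds the product of \<open>S\<close> with at most one
    further prime from \<open>R\<close>.\<close>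
  define e where "e = real d * real K / real (N + 1)"
  define B where "B = real n * real m ^ m"
  have fin: "finite S" "finite R" and disj: "S \<inter> R = {}"
    and SR: "{p. prime p \<and> p \<le> n} = S \<union> R"
    using m by (auto simp: S_def R_def)
  have primes: "prime p" if "p \<in> S \<union> R" for p
    using that by (auto simp: S_def R_def)
  have e0: "e \<ge> 0" by (simp add: e_def)
  have approx: "\<bar>avg ?W (g Q) - F Q\<bar> \<le> e * b" if "finite Q" "Q \<subseteq> S \<union> R" "real (\<Prod>Q) \<le> b" for Q b
  proof -
    have "\<bar>avg ?W (g Q) - F Q\<bar> \<le> real d * real K * (real (\<Prod>Q) / real (N + 1))"
      unfolding g_def F_def using that(2) primes by (intro avg_box_primes_approx that(1)) auto
    also have "\<dots> = e * real (\<Prod>Q)"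
      by (simp add: e_def)
    also have "\<dots> \<le> e * b"
      by (rule mult_left_mono[OF that(3) e0])
    finally show ?thesis .
  qed
  have cardR: "real (card R) \<le> real n"
  proof -
    have "R \<subseteq> {0<..n}" by (auto simp: R_def)
    then have "card R \<le> card {0<..n}" by (intro card_mono) auto
    then show ?thesis by simp
  qed
  have prodS: "real (\<Prod>S) \<le> real m ^ m"
  proof -
    have "card S \<le> card {0<..m}"
      by (intro card_mono) (auto simp: S_def prime_gt_0_nat)
    then have "card S \<le> m" by simp
    have "real (\<Prod>S) \<le> (\<Prod>p\<in>S. real m)"
      unfolding of_nat_prod by (intro prod_mono) (auto simp: S_def)
    also have "\<dots> \<le> real m ^ m"
      using \<open>card S \<le> m\<close> m by (simp add: power_increasing)
    finally show ?thesis .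
  qed
  have errS: "\<bar>avg ?W (g S) - F S\<bar> \<le> e * B"
  proof (rule approx)
    have "1 * real m ^ m \<le> real n * real m ^ m"
      using m by (intro mult_right_mono) auto
    with prodS show "real (\<Prod>S) \<le> B"
      by (simp add: B_def)
  qed (use fin in auto)
  have errSp: "\<bar>avg ?W (g (insert p S)) - F (insert p S)\<bar> \<le> e * B" if p: "p \<in> R" for p
  proof (rule approx)
    have "p \<notin> S" using p disj by auto
    then have "real (\<Prod>(insert p S)) = real p * real (\<Prod>S)"
      using fin by simp
    also have "\<dots> \<le> real n * real m ^ m"
      using p prodS by (intro mult_mono) (auto simp: R_def intro!: prod_nonneg)
    finally show "real (\<Prod>(insert p S)) \<le> B"
      by (simp add: B_def)
  qed (use fin p in auto)
  \<comment> \<open>The coarse bound \<open>n^2\<close> for a single prime matches the one for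
    pairs, so that the second order terms share one error.\<close>
  have errp: "\<bar>avg ?W (g {p}) - F {p}\<bar> \<le> e * real n ^ 2" if p: "p \<in> R" for p
  proof (rule approx)
    have "p \<le> n ^ 2"
      using p m by (auto simp: R_def power2_eq_square intro: order_trans)
    then have "real p \<le> real (n ^ 2)"
      by (rule of_nat_mono)
    then show "real (\<Prod>{p}) \<le> real n ^ 2"
      by simp
  qed (use p in auto)
  have errpq: "\<bar>avg ?W (g {p, q}) - F {p, q}\<bar> \<le> e * real n ^ 2" if pq: "p \<in> R" "q \<in> R" "p \<noteq> q" for p q
  proof (rule approx)
    have "real p * real q \<le> real n * real n"
      using pq by (intro mult_mono) (auto simp: R_def)
    then show "real (\<Prod>{p, q}) \<le> real n ^ 2"
      using pq by (simp add: power2_eq_square)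
  qed (use pq in auto)

  have x01: "x p v \<in> {0..1}" for p v
    by (simp add: x_def)
  have y01: "y p \<in> {0..1}" if "p \<in> S \<union> R" for p
    using local_density_bounds(1)[OF K prime_ge_2_nat[OF primes[OF that]]] by (simp add: y_def)
  have g01: "g Q v \<in> {0..1}" for Q v
    by (auto simp: g_def intro!: prod_nonneg prod_le_1)
  have FS: "F S \<in> {0..1}"
    using local_density_bounds(1)[OF K prime_ge_2_nat[OF primes]]
    by (auto simp: F_def intro!: prod_nonneg prod_le_1)

  \<comment> \<open>\<open>a\<close> and \<open>a'\<close> are the expansions up to first order for
    the box and for the product; \<open>b\<close> and \<open>b'\<close> are the second order terms
    without the factor from \<open>S\<close>. In \<open>b\<close> the product of two failure
    indicators is expanded by inclusion and exclusion into averages that \<open>approx\<close>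
    controls.\<close>
  define a where "a = avg ?W (g S) - (\<Sum>p\<in>R. avg ?W (g S) - avg ?W (g (insert p S)))"
  define a' where "a' = F S - (\<Sum>p\<in>R. F S - F (insert p S))"
  define b where "b = (\<Sum>p\<in>R. \<Sum>q\<in>R - {p}. 1 - avg ?W (g {p}) - avg ?W (g {q}) + avg ?W (g {p, q}))"
  define b' where "b' = (\<Sum>p\<in>R. \<Sum>q\<in>R - {p}. y p * y q)"

  have gS_x: "g S v * x p v = g S v - g (insert p S) v" if "p \<in> R" for p v
  proof -
    have "p \<notin> S" using that disj by auto
    with fin show ?thesis by (simp add: g_def x_def algebra_simps)
  qed
  have g_split: "g (S \<union> R) v = g S v * (\<Prod>p\<in>R. 1 - x p v)" for v
    using fin disj by (simp add: g_def x_def prod.union_disjoint)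
  have xx: "x p v * x q v = 1 - g {p} v - g {q} v + g {p, q} v" if "p \<noteq> q" for p q v
    using that by (simp add: x_def g_def algebra_simps)
  have gS_sum: "g S v * (1 - (\<Sum>p\<in>R. x p v)) = g S v - (\<Sum>p\<in>R. g S v - g (insert p S) v)" for v
    by (simp add: right_diff_distrib sum_distrib_left gS_x)
  have box_const: "avg ?W (\<lambda>_. 1) = 1"
    by (rule avg_const[OF finite_box_tuples box_tuples_nonempty])
  have "a = avg ?W (\<lambda>v. g S v - (\<Sum>p\<in>R. g S v - g (insert p S) v))"
    unfolding a_def by (simp only: avg_diff avg_sum)
  also have "\<dots> \<le> avg ?W (g (S \<union> R))"
  proof (rule avg_mono)
    fix v
    have "g S v * (1 - (\<Sum>p\<in>R. x p v)) \<le> g S v * (\<Prod>p\<in>R. 1 - x p v)"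
      using g01[of S v] x01 by (intro mult_left_mono Weierstrass_prod_ineq) auto
    then show "g S v - (\<Sum>p\<in>R. g S v - g (insert p S) v) \<le> g (S \<union> R) v"
      by (simp only: gS_sum g_split)
  qed
  finally have lower: "a \<le> avg ?W (g (S \<union> R))" .
  have "avg ?W (g (S \<union> R)) \<le> avg ?W (\<lambda>v. (g S v - (\<Sum>p\<in>R. g S v - g (insert p S) v))
      + (\<Sum>p\<in>R. \<Sum>q\<in>R - {p}. 1 - g {p} v - g {q} v + g {p, q} v))"
  proof (rule avg_mono)
    fix v
    let ?E = "\<Sum>p\<in>R. \<Sum>q\<in>R - {p}. x p v * x q v"
    have "?E \<ge> 0"
      using x01 by (intro sum_nonneg mult_nonneg_nonneg) auto
    have "g (S \<union> R) v \<le> g S v * (1 - (\<Sum>p\<in>R. x p v) + ?E)"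
      unfolding g_split using g01[of S v] x01 fin by (intro mult_left_mono prod_one_minus_le) auto
    also have "\<dots> = g S v * (1 - (\<Sum>p\<in>R. x p v)) + g S v * ?E"
      by (rule distrib_left)
    \<comment> \<open>Bounding \<open>g S v\<close> by 1 here removes the primes of \<open>S\<close>
      from the moduli of the second order terms.\<close>
    also have "\<dots> \<le> g S v * (1 - (\<Sum>p\<in>R. x p v)) + 1 * ?E"
      using g01[of S v] \<open>?E \<ge> 0\<close> by (intro add_left_mono mult_right_mono) auto
    also have "1 * ?E = (\<Sum>p\<in>R. \<Sum>q\<in>R - {p}. 1 - g {p} v - g {q} v + g {p, q} v)"
      by (simp add: xx)
    finally show "g (S \<union> R) v \<le> g S v - (\<Sum>p\<in>R. g S v - g (insert p S) v)
        + (\<Sum>p\<in>R. \<Sum>q\<in>R - {p}. 1 - g {p} v - g {q} v + g {p, q} v)"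
      by (simp only: gS_sum)
  qed
  also have "\<dots> = a + b"
    unfolding a_def b_def by (simp only: avg_diff avg_sum avg_add box_const)
  finally have upper: "avg ?W (g (S \<union> R)) \<le> a + b" .

  have F_split: "F (S \<union> R) = F S * (\<Prod>p\<in>R. 1 - y p)"
    using fin disj by (simp add: F_def y_def prod.union_disjoint)
  have FS_y: "F S * y p = F S - F (insert p S)" if "p \<in> R" for p
  proof -
    have "p \<notin> S" using that disj by auto
    with fin show ?thesis by (simp add: F_def y_def algebra_simps)
  qed
  have FS_sum: "F S * (1 - (\<Sum>p\<in>R. y p)) = a'"
    unfolding a'_def by (simp add: right_diff_distrib sum_distrib_left FS_y)
  have "F S * (1 - (\<Sum>p\<in>R. y p)) \<le> F S * (\<Prod>p\<in>R. 1 - y p)"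
    using FS y01 by (intro mult_left_mono Weierstrass_prod_ineq) auto
  then have lower': "a' \<le> F (S \<union> R)"
    by (simp only: FS_sum F_split)
  have b'0: "b' \<ge> 0"
    unfolding b'_def using y01 by (intro sum_nonneg mult_nonneg_nonneg) auto
  have "F (S \<union> R) \<le> F S * (1 - (\<Sum>p\<in>R. y p) + b')"
    unfolding F_split b'_def using FS y01 fin by (intro mult_left_mono prod_one_minus_le) auto
  also have "\<dots> = a' + F S * b'"
    by (simp add: distrib_left FS_sum)
  also have "\<dots> \<le> a' + 1 * b'"
    using FS b'0 by (intro add_left_mono mult_right_mono) auto
  finally have upper': "F (S \<union> R) \<le> a' + b'" by simp
  have b'_le: "b' \<le> (\<Sum>p\<in>R. y p)\<^sup>2"
    unfolding b'_def power2_eq_square sum_product using y01 fin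
    by (intro sum_mono sum_mono2) auto

  have "\<bar>a - a'\<bar> \<le> e * B * (1 + 2 * real n)"
  proof -
    have "a - a' = (avg ?W (g S) - F S)
        - (\<Sum>p\<in>R. (avg ?W (g S) - F S) - (avg ?W (g (insert p S)) - F (insert p S)))"
      unfolding a_def a'_def sum_subtractf by linarith
    \<comment> \<open>Each prime of \<open>R\<close> contributes two errors, one for
      \<open>S\<close> alone and one for \<open>S\<close> with \<open>p\<close>.\<close>
    also have "\<bar>\<dots>\<bar> \<le> e * B + (\<Sum>p\<in>R. 2 * (e * B))"
    proof -
      have "\<bar>\<Sum>p\<in>R. (avg ?W (g S) - F S) - (avg ?W (g (insert p S)) - F (insert p S))\<bar>
          \<le> (\<Sum>p\<in>R. 2 * (e * B))"
        by (rule order_trans[OF sum_abs], rule sum_mono) (use errS errSp in force)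
      with errS show ?thesis by linarith
    qed
    also have "\<dots> = e * B * (1 + 2 * real (card R))"
      by (simp add: algebra_simps)
    also have "\<dots> \<le> e * B * (1 + 2 * real n)"
      using cardR e0 by (intro mult_left_mono mult_nonneg_nonneg) (auto simp: B_def)
    finally show ?thesis .
  qed
  moreover have "\<bar>b - b'\<bar> \<le> e * (3 * real n ^ 4)"
  proof -
    have yy: "y p * y q = 1 - F {p} - F {q} + F {p, q}" if "p \<noteq> q" for p q
      using that by (simp add: y_def F_def algebra_simps)
    have "b - b' = (\<Sum>p\<in>R. \<Sum>q\<in>R - {p}. (F {p} - avg ?W (g {p})) + (F {q} - avg ?W (g {q}))
        + (avg ?W (g {p, q}) - F {p, q}))"
      unfolding b_def b'_def sum_subtractf[symmetric]
      by (intro sum.cong refl) (auto simp: yy)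
    also have "\<bar>\<dots>\<bar> \<le> (\<Sum>p\<in>R. \<Sum>q\<in>R - {p}. 3 * (e * real n ^ 2))"
    proof (rule order_trans[OF sum_abs], rule sum_mono, rule order_trans[OF sum_abs], rule sum_mono)
      fix p q assume pq: "p \<in> R" "q \<in> R - {p}"
      then show "\<bar>(F {p} - avg ?W (g {p})) + (F {q} - avg ?W (g {q})) + (avg ?W (g {p, q}) - F {p, q})\<bar>
          \<le> 3 * (e * real n ^ 2)"
        using errp[of p] errp[of q] errpq[of p q] by auto
    qed
    also have "\<dots> \<le> (\<Sum>p\<in>R. \<Sum>q\<in>R. 3 * (e * real n ^ 2))"
      by (intro sum_mono, rule sum_mono2) (use fin e0 in auto)
    also have "\<dots> = (real (card R) * real (card R)) * (3 * (e * real n ^ 2))"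
      by simp
    also have "\<dots> \<le> (real n * real n) * (3 * (e * real n ^ 2))"
      using cardR e0 by (intro mult_right_mono mult_mono) auto
    also have "\<dots> = e * (3 * real n ^ 4)"
      by (simp add: power2_eq_square power4_eq_xxxx)
    finally show ?thesis .
  qed
  \<comment> \<open>The two quantities lie in the intervals from \<open>a\<close> to
    \<open>a + b\<close> and from \<open>a'\<close> to \<open>a' + b'\<close>, so they differ by at
    most \<open>\<bar>a - a'\<bar> + \<bar>b - b'\<bar> + b'\<close>.\<close>
  ultimately have "\<bar>avg ?W (g (S \<union> R)) - F (S \<union> R)\<bar>
      \<le> e * B * (1 + 2 * real n) + e * (3 * real n ^ 4) + (\<Sum>p\<in>R. y p)\<^sup>2"
    using lower upper lower' upper' b'_le b'0 by linarith
  also have "e * B * (1 + 2 * real n) + e * (3 * real n ^ 4)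
      = e * (real n * real m ^ m * (1 + 2 * real n) + 3 * real n ^ 4)"
    by (simp add: B_def algebra_simps)
  finally show ?thesis
    unfolding SR e_def g_def F_def y_def .
qed

section \<open>Choice of the parameters and conclusion\<close>

text \<open>The logarithm of the left side is of order m log m, hence negligible against a quadratic
  exponent. The constant 8 under the square fits \<open>m - 1 \<le> 2 * sqrt (ln N)\<close>, which
  turns the exponential into at most \<open>sqrt N\<close>.\<close>

lemma power_self_le_exp_square:
  "\<exists>C > 0. \<forall>m :: nat. real m ^ (m + 8) \<le> C * exp ((real m - 1)\<^sup>2 / 8)"
proof -
  have "((\<lambda>m :: nat. exp ((real m + 8) * ln (real m)) / exp ((real m - 1)\<^sup>2 / 8)) \<longlongrightarrow> 0) sequentially"
    by real_asymp
  then have "Bseq (\<lambda>m :: nat. exp ((real m + 8) * ln (real m)) / exp ((real m - 1)\<^sup>2 / 8))"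
    by (rule convergent_imp_Bseq[OF convergentI])
  then obtain c where c: "\<And>m :: nat. \<bar>exp ((real m + 8) * ln (real m)) / exp ((real m - 1)\<^sup>2 / 8)\<bar> \<le> c"
    by (auto simp: Bseq_def)
  have "real m ^ (m + 8) \<le> max c 1 * exp ((real m - 1)\<^sup>2 / 8)" for m :: nat
  proof (cases "m = 0")
    case False
    then have "real m ^ (m + 8) = exp ((real m + 8) * ln (real m))"
      using powr_realpow[of "real m" "m + 8"] by (simp add: powr_def)
    also have "\<dots> \<le> c * exp ((real m - 1)\<^sup>2 / 8)"
      using c[of m] by (simp add: abs_le_iff divide_le_eq)
    also have "\<dots> \<le> max c 1 * exp ((real m - 1)\<^sup>2 / 8)"
      by (intro mult_right_mono) auto
    finally show ?thesis .
  qed simp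
  then show ?thesis
    by (intro exI[of _ "max c 1"]) auto
qed

theorem theorem2:
  shows "\<exists>C::real. C > 0 \<and>
    (\<forall>d N K :: nat. d \<ge> 2 \<longrightarrow> N \<ge> 2 \<longrightarrow> 2 \<le> K \<longrightarrow> K \<le> 2 ^ d \<longrightarrow>
      \<bar>real (card (visible_tuples d N K)) / real (card (box_tuples d N K))
         - visibility_product d K\<bar>
      \<le> C * (real d * real K / sqrt (real N)
               + 2 ^ d * (real K)\<^sup>2 / ln (real N) ^ (d - 1)))"
proof -
  obtain c where c: "c > 0" "\<And>m :: nat. real m ^ (m + 8) \<le> c * exp ((real m - 1)\<^sup>2 / 8)"
    using power_self_le_exp_square by blast
  \<comment> \<open>In \<open>6 * c + 3\<close>, the part \<open>6 * c\<close> comes from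
    equidistribution in the sieve, and 3 counts the errors \<open>T\<close> from large primes, from
    the tail of the product and from second order terms.\<close>
  have "\<bar>real (card (visible_tuples d N K)) / real (card (box_tuples d N K)) - visibility_product d K\<bar>
      \<le> (6 * c + 3) * (real d * real K / sqrt (real N) + 2 ^ d * (real K)\<^sup>2 / ln (real N) ^ (d - 1))"
    if d: "d \<ge> 2" and N: "N \<ge> 2" and K: "K \<le> 2 ^ d" for d N K :: nat
  proof -
    define L where "L = ln (real N)"
    define m where "m = nat \<lceil>2 * sqrt L\<rceil>"
    define n where "n = m\<^sup>2"
    define T where "T = 2 ^ d * (real K)\<^sup>2 / L ^ (d - 1)"
    define G where "G = avg (box_tuples d N K) (\<lambda>v. \<Prod>p | prime p \<and> p \<le> n. of_bool (distinct_mod d K p v))"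
    define F where "F = (\<Prod>p | prime p \<and> p \<le> n. local_density d K p)"
    \<comment> \<open>Already \<open>N = 2\<close> gives \<open>L > 1 / 4\<close>, so
      \<open>2 * sqrt L > 1\<close> and \<open>m \<ge> 2\<close>, as the prime 2 and the later power
      estimates require.\<close>
    have "exp (1 / 3 :: real) \<le> 2"
      using exp_bound[of "1 / 3"] by (simp add: power2_eq_square)
    then have "exp (1 / 3) \<le> real N"
      using N by linarith
    then have L: "L > 1 / 4"
      using N ln_ge_iff[of "real N" "1 / 3"] by (simp add: L_def)
    have m_ge: "2 * sqrt L \<le> real m" and m_le: "real m - 1 \<le> 2 * sqrt L"
      using L real_sqrt_ge_zero[of L] ceiling_correct[of "2 * sqrt L"] unfolding m_def
      by (auto simp: ceiling_le_iff real_nat_ceiling_ge)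
    have "sqrt L > 1 / 2"
      using L by (intro real_less_rsqrt) (simp add: power2_eq_square)
    with m_ge have m2: "m \<ge> 2" by linarith
    have n_ge: "n \<ge> 2" "m \<le> n"
      using m2 self_le_power[of m 2] by (auto simp: n_def)
    have n4L: "4 * L \<le> real n"
      using power_mono[OF m_ge, of 2] L by (simp add: n_def power_mult_distrib)
    then have nL: "L \<le> real n"
      using L by linarith
    have powT: "2 ^ d * (real K)\<^sup>2 / real n ^ (d - 1) \<le> T"
      unfolding T_def using nL L by (intro frac_le power_mono) auto

    have visible_part: "\<bar>real (card (visible_tuples d N K)) / real (card (box_tuples d N K)) - G\<bar> \<le> T"
      unfolding G_def by (rule order_trans[OF visible_tuples_avg_bounds[OF d n_ge(1)] powT])

    have product_part: "\<bar>visibility_product d K - F\<bar> \<le> T"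
    proof -
      have "\<bar>visibility_product d K - F\<bar> \<le> 1 * ((real K)\<^sup>2 / real n ^ (d - 1))"
        using visibility_product_approx[OF d K, of n] n_ge by (simp add: F_def)
      also have "\<dots> \<le> 2 ^ d * ((real K)\<^sup>2 / real n ^ (d - 1))"
        by (intro mult_right_mono) auto
      finally show ?thesis
        using powT by simp
    qed

    have sieve_part: "\<bar>G - F\<bar> \<le> 6 * c * (real d * real K / sqrt (real N)) + T"
    proof -
      define R where "R = {p. prime p \<and> m < p \<and> p \<le> n}"
      have "real n * real m ^ m * (1 + 2 * real n) + 3 * real n ^ 4
          = real m ^ (m + 2) + 2 * real m ^ (m + 4) + 3 * real m ^ 8"
      proof -
        have "real m ^ 8 = (real m ^ 2) ^ 4"
          by (simp flip: power_mult)
        then show ?thesis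
          by (simp add: n_def power_add algebra_simps power2_eq_square power4_eq_xxxx)
      qed
      \<comment> \<open>All three exponents are at most \<open>m + 8\<close>; the coefficients add
        up to 6.\<close>
      also have "\<dots> \<le> real m ^ (m + 8) + 2 * real m ^ (m + 8) + 3 * real m ^ (m + 8)"
        using m2 by (intro add_mono mult_left_mono power_increasing) auto
      also have "\<dots> \<le> 6 * c * exp ((real m - 1)\<^sup>2 / 8)"
        using c(2)[of m] by simp
      also have "\<dots> \<le> 6 * c * sqrt (real N)"
      proof -
        have "(real m - 1)\<^sup>2 \<le> (2 * sqrt L)\<^sup>2"
          using m2 by (intro power_mono m_le) auto
        then have "(real m - 1)\<^sup>2 / 8 \<le> L / 2"
          using L by (simp add: power_mult_distrib)
        moreover have "exp (L / 2) = sqrt (real N)"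
          using N by (simp add: L_def powr_half_sqrt[symmetric] powr_def)
        ultimately have "exp ((real m - 1)\<^sup>2 / 8) \<le> sqrt (real N)"
          by (metis exp_le_cancel_iff)
        then show ?thesis
          using c(1) by (intro mult_left_mono) auto
      qed
      finally have err: "real n * real m ^ m * (1 + 2 * real n) + 3 * real n ^ 4 \<le> 6 * c * sqrt (real N)" .
      have "real d * real K / real (N + 1) * (real n * real m ^ m * (1 + 2 * real n) + 3 * real n ^ 4)
          \<le> real d * real K / real N * (6 * c * sqrt (real N))"
        using N err by (intro mult_mono divide_left_mono) auto
      also have "\<dots> = 6 * c * (real d * real K / sqrt (real N))"
        using N by (simp add: field_simps)
      finally have 1: "real d * real K / real (N + 1) * (real n * real m ^ m * (1 + 2 * real n) + 3 * real n ^ 4)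
          \<le> 6 * c * (real d * real K / sqrt (real N))" .

      have primes: "p \<ge> 2" if "p \<in> R" for p
        using that by (auto simp: R_def prime_ge_2_nat)
      have "(\<Sum>p\<in>R. 1 - local_density d K p) \<le> (\<Sum>p\<in>R. (real K)\<^sup>2 / real p ^ d)"
        by (intro sum_mono local_density_bounds K primes)
      also have "\<dots> \<le> (\<Sum>p\<in>{m<..n}. (real K)\<^sup>2 / real p ^ d)"
        by (intro sum_mono2) (auto simp: R_def)
      also have "\<dots> = (real K)\<^sup>2 * (\<Sum>p\<in>{m<..n}. 1 / real p ^ d)"
        by (simp add: sum_distrib_left)
      also have "\<dots> \<le> (real K)\<^sup>2 * (1 / real m ^ (d - 1))"
        using m2 by (intro mult_left_mono sum_inverse_power_tail d) auto
      finally have "(\<Sum>p\<in>R. 1 - local_density d K p) \<le> (real K)\<^sup>2 / real m ^ (d - 1)"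
        by simp
      moreover have "0 \<le> (\<Sum>p\<in>R. 1 - local_density d K p)"
        using local_density_bounds(1)[OF K primes] by (intro sum_nonneg) auto
      ultimately have "(\<Sum>p\<in>R. 1 - local_density d K p)\<^sup>2 \<le> ((real K)\<^sup>2 / real m ^ (d - 1))\<^sup>2"
        by (rule power_mono)
      also have "\<dots> = (real K)\<^sup>2 * (real K)\<^sup>2 / real n ^ (d - 1)"
        by (simp add: n_def power_divide power2_eq_square power_mult_distrib)
      \<comment> \<open>One factor \<open>K^2\<close> is at most \<open>4 ^ d\<close>, which is at
        most \<open>2 ^ d * 4 ^ (d - 1)\<close> because \<open>d \<ge> 2\<close>. The power of 4
        cancels against \<open>n \<ge> 4 * L\<close>; this is the purpose of the 2 in the choice of
        \<open>m\<close>.\<close>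
      also have "\<dots> \<le> (real K)\<^sup>2 * (2 ^ d * 4 ^ (d - 1)) / (4 * L) ^ (d - 1)"
      proof (rule frac_le)
        have "real K \<le> real (2 ^ d)"
          using K by (rule of_nat_mono)
        then have "(real K)\<^sup>2 \<le> (2 ^ d)\<^sup>2"
          by (intro power_mono) auto
        also have "(2 ^ d :: real)\<^sup>2 = 2 ^ (d + d)"
          by (simp add: power2_eq_square power_add)
        also have "\<dots> \<le> 2 ^ (d + 2 * (d - 1))"
          using d by (intro power_increasing) auto
        also have "\<dots> = (2 ^ d * 4 ^ (d - 1) :: real)"
          by (simp add: power_add power_mult)
        finally show "(real K)\<^sup>2 * (real K)\<^sup>2 \<le> (real K)\<^sup>2 * (2 ^ d * 4 ^ (d - 1))"
          by (intro mult_left_mono) auto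
        show "(4 * L) ^ (d - 1) \<le> real n ^ (d - 1)"
          using L n4L by (intro power_mono) auto
      qed (use L in auto)
      also have "\<dots> = T"
        by (simp add: T_def power_mult_distrib)
      finally have 2: "(\<Sum>p\<in>R. 1 - local_density d K p)\<^sup>2 \<le> T" .
      have "\<bar>G - F\<bar> \<le> real d * real K / real (N + 1) * (real n * real m ^ m * (1 + 2 * real n) + 3 * real n ^ 4)
          + (\<Sum>p\<in>R. 1 - local_density d K p)\<^sup>2"
        unfolding G_def F_def R_def using m2 n_ge by (intro avg_box_sieve K) auto
      with 1 2 show ?thesis by linarith
    qed

    define A where "A = real d * real K / sqrt (real N)"
    \<comment> \<open>These nonnegative cross terms complete \<open>6 * c * A + 3 * T\<close> to a
      single constant times \<open>A + T\<close>.\<close>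
    have "0 \<le> 3 * A" "0 \<le> 6 * c * T"
      using c(1) L by (auto simp: A_def T_def)
    moreover have "(6 * c + 3) * (A + T) = 6 * c * A + 3 * T + 3 * A + 6 * c * T"
      by (simp only: distrib_left distrib_right)
    moreover have "\<bar>real (card (visible_tuples d N K)) / real (card (box_tuples d N K)) - visibility_product d K\<bar>
        \<le> 6 * c * A + 3 * T"
      using visible_part product_part sieve_part unfolding A_def by linarith
    ultimately show ?thesis
      unfolding A_def[symmetric] T_def[unfolded L_def, symmetric] by linarith
  qed
  then show ?thesis
    using c(1) by (intro exI[of _ "6 * c + 3"]) auto
qed

end
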